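(* For all characters $A,B,B',C\in\widehat{\mathbb F_q}$ and all $x,y\in\mathbb F_q$, the following two identities hold. (1) $$\varepsilon(x-y)\,\mathbb F_1(A;B,B';C;x,y)=\varepsilon(x)\,\overline A(1-y)\;\mathbb F_1\left(A;B,\overline{BB'}C;C;\frac{x-y}{1-y},\frac y{y-1}\right).$$ (2) $$\varepsilon(x-y)\,\mathbb F_1(A;B,B';C;x,y)=\varepsilon(x)\,C(-1)\,\overline B(1-x)\,\overline{AB'}C(1-y)\;\mathbb F_1\left(\overline AC;B,\overline{BB'}C;C;\frac{y-x}{1-x},y\right).$$
   Context: Let $p$ be a prime, $r\ge1$ an integer, $q=p^r$, and $\mathbb F_q$ the finite field with $q$ elements. $\widehat{\mathbb F_q}$ denotes the group of (complex-valued) multiplicative characters of $\mathbb F_q^*$; every character $\chi$, including the trivial character $\varepsilon$, is extended to $\mathbb F_q$ by $\chi(0)=0$. $\overline\chi$ is the inverse of $\chi$. Juxtaposition of characters denotes their product, and e.g. $AC(-1)$ means $(AC)(-1)$, $\overline AC$ means the product of $\overline A$ and $C$, $\overline{BB'}C$ means the product of $\overline B$, $\overline{B'}$ and $C$, and $\overline{AB'}C(1-y)$ is the value of the product character $\overline A\,\overline{B'}C$ at $1-y$. For $A,B,B',C\in\widehat{\mathbb F_q}$ and $x,y\in\mathbb F_q$, $$\mathbb F_1(A;B,B';C;x,y)=\varepsilon(xy)\,AC(-1)\sum_{u\in\mathbb F_q}A(u)\,\overline AC(1-u)\,\overline B(1-ux)\,\overline{B'}(1-uy).$$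
   Formalization: Identity (1) is proved for y ≠ 1 and identity (2) for x ≠ 1 and y ≠ 1: otherwise a fraction has denominator zero, or, for (2) at y = 1, the identity fails (q = 5, all characters trivial, x = 2, y = 1 gives 2 on the left and 0 on the right). *)

theory Defs
  imports
    Complex_Main
    "HOL-Computational_Algebra.Primes"
    "HOL-Library.Cardinality"
begin

text \<open>
  A multiplicative character is a homomorphism from the group of nonzero elements to the nonzero
  complex numbers. It is represented as a function on the whole field, extended by 0 at 0.
  This applies to the trivial character as well, so the constant function 1 is not a character.
\<close>

definition mult_char :: "('a::field \<Rightarrow> complex) \<Rightarrow> bool" where
  "mult_char \<chi> \<longleftrightarrow>
     \<chi> 0 = 0 \<and> (\<forall>a. a \<noteq> 0 \<longrightarrow> \<chi> a \<noteq> 0) \<and>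
     (\<forall>a b. a \<noteq> 0 \<longrightarrow> b \<noteq> 0 \<longrightarrow> \<chi> (a * b) = \<chi> a * \<chi> b)"

definition triv_char :: "'a::field \<Rightarrow> complex" where
  "triv_char a = (if a = 0 then 0 else 1)"

definition char_mult :: "('a::field \<Rightarrow> complex) \<Rightarrow> ('a \<Rightarrow> complex) \<Rightarrow> 'a \<Rightarrow> complex"
    (infixl \<open>\<odot>\<close> 70) where
  "(\<chi> \<odot> \<psi>) a = \<chi> a * \<psi> a"

text \<open>The value at 0 is again 0, because \<open>inverse 0 = 0\<close> in the complex numbers.\<close>

definition char_inv :: "('a::field \<Rightarrow> complex) \<Rightarrow> 'a \<Rightarrow> complex" where
  "char_inv \<chi> a = inverse (\<chi> a)"

text \<open>The multiplicative characters form a commutative group under these operations.\<close>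

lemma mult_char_triv_char: "mult_char triv_char"
  by (simp add: mult_char_def triv_char_def)

lemma mult_char_char_mult: "mult_char \<chi> \<Longrightarrow> mult_char \<psi> \<Longrightarrow> mult_char (\<chi> \<odot> \<psi>)"
  by (simp add: mult_char_def char_mult_def)

lemma mult_char_char_inv: "mult_char \<chi> \<Longrightarrow> mult_char (char_inv \<chi>)"
  by (simp add: mult_char_def char_inv_def)

lemma char_mult_assoc: "(\<chi> \<odot> \<psi>) \<odot> \<phi> = \<chi> \<odot> (\<psi> \<odot> \<phi>)"
  by (rule ext) (simp add: char_mult_def)

lemma char_mult_commute: "\<chi> \<odot> \<psi> = \<psi> \<odot> \<chi>"
  by (rule ext) (simp add: char_mult_def)

lemma char_mult_triv_char: "mult_char \<chi> \<Longrightarrow> triv_char \<odot> \<chi> = \<chi>"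
  by (rule ext) (simp add: mult_char_def char_mult_def triv_char_def)

lemma char_mult_char_inv: "mult_char \<chi> \<Longrightarrow> char_inv \<chi> \<odot> \<chi> = triv_char"
  by (rule ext) (simp add: mult_char_def char_mult_def char_inv_def triv_char_def)

text \<open>The finite field analogue of the Appell series \<open>F\<^sub>1(A; B, B'; C; x, y)\<close>.\<close>

definition appell_F1 ::
  "('a::{field,finite} \<Rightarrow> complex) \<Rightarrow> ('a \<Rightarrow> complex) \<Rightarrow> ('a \<Rightarrow> complex) \<Rightarrow> ('a \<Rightarrow> complex)
     \<Rightarrow> 'a \<Rightarrow> 'a \<Rightarrow> complex" where
  "appell_F1 A B B' C x y =
     triv_char (x * y) * (A \<odot> C) (- 1) *
       (\<Sum>u\<in>UNIV. A u * (char_inv A \<odot> C) (1 - u) * char_inv B (1 - u * x) * char_inv B' (1 - u * y))"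

end

theory Submission
  imports Defs
begin

text \<open>
  The sum in \<open>appell_F1\<close> is the finite field form of Euler's integral, and both identities come
  from a Moebius substitution in the summation variable, exactly as for the classical
  Appell series. Each substitution carries the points \<open>0\<close>, \<open>1\<close>, \<open>1 / x\<close>, \<open>1 / y\<close>, \<open>\<infinity>\<close>, where
  the characters of the summand can have argument \<open>0\<close> or \<open>\<infinity>\<close>, to the corresponding points of
  the transformed summand:

    \<^item> \<open>v = (1 - y) u / (1 - u y)\<close> fixes \<open>0\<close> and \<open>1\<close> and sends \<open>1 / y\<close> to \<open>\<infinity>\<close>;
    \<^item> \<open>v = (1 - u) / (1 - u y)\<close> exchanges \<open>0\<close> with \<open>1\<close>, and \<open>1 / y\<close> with \<open>\<infinity>\<close>.

  In both cases every linear factor of the summand in \<open>v\<close> is a constant times a linear factor in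
  \<open>u\<close>, divided by \<open>1 - u y\<close>. By multiplicativity the constants leave the sum as the outer factors,
  and the powers of \<open>1 - u y\<close> collect into a single character value, which is why the third
  parameter of the transformed function is the inverse of \<open>B\<close> times the inverse of \<open>B'\<close> times \<open>C\<close>.

  If \<open>y \<noteq> 0\<close>, the substitution is not a bijection of the whole field, since it has a pole
  at \<open>u = 1 / y\<close> and misses the image of \<open>\<infinity>\<close>. These points contribute nothing: the characters
  vanish at \<open>0\<close>, the trivial one included, so each of the two summands vanishes at its own
  exceptional point.
\<close>

lemma mult_char_one: "mult_char \<chi> \<Longrightarrow> \<chi> 1 = 1"
  unfolding mult_char_def by (metis mult_cancel_right2 mult_1 one_neq_zero)

lemma mult_char_eq_0_iff: "mult_char \<chi> \<Longrightarrow> \<chi> a = 0 \<longleftrightarrow> a = 0"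
  by (auto simp: mult_char_def)

lemma mult_char_mult: "mult_char \<chi> \<Longrightarrow> \<chi> (a * b) = \<chi> a * \<chi> b"
  by (cases "a = 0 \<or> b = 0") (auto simp: mult_char_def)

lemma mult_char_divide:
  assumes "mult_char \<chi>"
  shows "\<chi> (a / b) = \<chi> a / \<chi> b"
proof (cases "b = 0")
  case True
  then show ?thesis using assms by (simp add: mult_char_def)
next
  case False
  then have "\<chi> a = \<chi> (a / b) * \<chi> b"
    using mult_char_mult[OF assms, of "a / b" b] by simp
  then show ?thesis using False assms by (simp add: mult_char_eq_0_iff)
qed

lemma mult_char_minus_one_square: "mult_char \<chi> \<Longrightarrow> \<chi> (- 1) * \<chi> (- 1) = 1"
  using mult_char_mult[of \<chi> "- 1" "- 1"] by (simp add: mult_char_one)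

text \<open>
  The form in which a Moebius substitution is used: \<open>S\<close> and \<open>T\<close> are the sets on which the
  substitution and its inverse have no pole, and the summands vanish at the poles.
\<close>

lemma sum_UNIV_reindex_on_support:
  fixes f :: "'a::finite \<Rightarrow> 'c::comm_monoid_add" and g :: "'b::finite \<Rightarrow> 'c"
  assumes "\<And>u. u \<notin> S \<Longrightarrow> f u = 0" and "\<And>v. v \<notin> T \<Longrightarrow> g v = 0"
    and "\<And>u. u \<in> S \<Longrightarrow> i u \<in> T" and "\<And>v. v \<in> T \<Longrightarrow> j v \<in> S"
    and "\<And>u. u \<in> S \<Longrightarrow> j (i u) = u" and "\<And>v. v \<in> T \<Longrightarrow> i (j v) = v"
    and "\<And>u. u \<in> S \<Longrightarrow> g (i u) = f u"
  shows "sum f UNIV = sum g UNIV"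
proof -
  have "sum f UNIV = sum f S"
    by (rule sum.mono_neutral_right) (use assms(1) in auto)
  also have "\<dots> = sum g T"
    by (rule sum.reindex_bij_witness[where i = j and j = i]) (use assms in auto)
  also have "\<dots> = sum g UNIV"
    by (rule sum.mono_neutral_left) (use assms(2) in auto)
  finally show ?thesis .
qed

text \<open>
  The substitution \<open>v = (1 - y) u / (1 - u y)\<close>, with inverse \<open>u = v / (1 - y + v y)\<close>. Only the
  character at \<open>v\<close> leaves a constant outside the sum: the factors \<open>1 - v\<close> and \<open>1 - v X\<close>, where
  \<open>X\<close> is the new first variable, are exactly \<open>(1 - u) / (1 - u y)\<close> and
  \<open>(1 - u x) / (1 - u y)\<close>, and \<open>1 - v Y\<close>, where \<open>Y\<close> is the new second variable, is
  \<open>1 / (1 - u y)\<close>.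
\<close>

lemma euler_sum_fix_0_1:
  fixes A B B' C :: "'a::{field,finite} \<Rightarrow> complex" and x y :: 'a
  defines "D \<equiv> char_inv B \<odot> char_inv B' \<odot> C"
  assumes chars: "mult_char A" "mult_char B" "mult_char B'" "mult_char C"
    and y: "y \<noteq> 1"
  shows "(\<Sum>u\<in>UNIV. A u * (char_inv A \<odot> C) (1 - u) * char_inv B (1 - u * x) *
            char_inv B' (1 - u * y)) =
         char_inv A (1 - y) *
         (\<Sum>v\<in>UNIV. A v * (char_inv A \<odot> C) (1 - v) * char_inv B (1 - v * ((x - y) / (1 - y))) *
            char_inv D (1 - v * (y / (y - 1))))"
  unfolding sum_distrib_left
proof (rule sum_UNIV_reindex_on_support[where S = "{u. 1 - u * y \<noteq> 0}"
        and T = "{v. 1 - v * (y / (y - 1)) \<noteq> 0}"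
        and i = "\<lambda>u. (1 - y) * u / (1 - u * y)" and j = "\<lambda>v. v / (1 - y + v * y)"])
  have D: "mult_char D"
    unfolding D_def by (intro mult_char_char_mult mult_char_char_inv chars)
  have AC: "mult_char (char_inv A \<odot> C)"
    by (intro mult_char_char_mult mult_char_char_inv chars)
  have y': "1 - y \<noteq> 0" "y - 1 \<noteq> 0" using y by auto
  have E: "1 - v * (y / (y - 1)) = (1 - y + v * y) / (1 - y)" for v
    using y' by (simp add: field_simps)
  show "A u * (char_inv A \<odot> C) (1 - u) * char_inv B (1 - u * x) * char_inv B' (1 - u * y) = 0"
    if "u \<notin> {u. 1 - u * y \<noteq> 0}" for u
    using that chars by (simp add: char_inv_def mult_char_def)
  show "char_inv A (1 - y) * (A v * (char_inv A \<odot> C) (1 - v) *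
          char_inv B (1 - v * ((x - y) / (1 - y))) * char_inv D (1 - v * (y / (y - 1)))) = 0"
    if "v \<notin> {v. 1 - v * (y / (y - 1)) \<noteq> 0}" for v
    using that D by (simp add: char_inv_def mult_char_def)
  show "v / (1 - y + v * y) \<in> {u. 1 - u * y \<noteq> 0}"
    "(1 - y) * (v / (1 - y + v * y)) / (1 - v / (1 - y + v * y) * y) = v"
    if "v \<in> {v. 1 - v * (y / (y - 1)) \<noteq> 0}" for v
  proof -
    have nz: "1 - y + v * y \<noteq> 0" using that unfolding mem_Collect_eq E by (metis div_0)
    have d: "1 - v / (1 - y + v * y) * y = (1 - y) / (1 - y + v * y)"
      using nz by (simp add: field_simps)
    show "v / (1 - y + v * y) \<in> {u. 1 - u * y \<noteq> 0}"
      using nz y' by (simp only: d mem_Collect_eq) simp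
    show "(1 - y) * (v / (1 - y + v * y)) / (1 - v / (1 - y + v * y) * y) = v"
      unfolding d using nz y' by simp
  qed
  fix u assume "u \<in> {u. 1 - u * y \<noteq> 0}"
  then have d: "1 - u * y \<noteq> 0" by simp
  let ?v = "(1 - y) * u / (1 - u * y)"
  have e: "1 - y + ?v * y = (1 - y) / (1 - u * y)"
    using d by (simp add: field_simps)
  show "?v \<in> {v. 1 - v * (y / (y - 1)) \<noteq> 0}"
    unfolding mem_Collect_eq E e using d y' by simp
  show "?v / (1 - y + ?v * y) = u"
    unfolding e using d y' by simp
  have v: "1 - ?v = (1 - u) / (1 - u * y)"
    "1 - ?v * ((x - y) / (1 - y)) = (1 - u * x) / (1 - u * y)"
    "1 - ?v * (y / (y - 1)) = 1 / (1 - u * y)"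
  proof -
    show "1 - ?v = (1 - u) / (1 - u * y)"
      using d by (simp add: field_simps)
    have "?v * ((x - y) / (1 - y)) = u * (x - y) / (1 - u * y)"
      using y' by simp
    then show "1 - ?v * ((x - y) / (1 - y)) = (1 - u * x) / (1 - u * y)"
      using d by (simp add: field_simps)
    show "1 - ?v * (y / (y - 1)) = 1 / (1 - u * y)"
      unfolding E e using y' by simp
  qed
  have ndz: "A (1 - u * y) \<noteq> 0" "B (1 - u * y) \<noteq> 0" "B' (1 - u * y) \<noteq> 0"
    "C (1 - u * y) \<noteq> 0" "A (1 - y) \<noteq> 0"
    using d y' chars by (simp_all add: mult_char_eq_0_iff)
  have a: "A ?v = A (1 - y) * A u / A (1 - u * y)"
    using chars by (simp add: mult_char_divide mult_char_mult)
  have ac: "(char_inv A \<odot> C) (1 - ?v) = (char_inv A \<odot> C) (1 - u) * A (1 - u * y) / C (1 - u * y)"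
    unfolding v(1) by (simp add: mult_char_divide[OF AC] char_mult_def[of _ _ "1 - u * y"]
        char_inv_def[of A "1 - u * y"] field_simps)
  have b: "char_inv B (1 - ?v * ((x - y) / (1 - y))) = char_inv B (1 - u * x) * B (1 - u * y)"
    unfolding v(2) char_inv_def using chars by (simp add: mult_char_divide) (simp add: divide_inverse)
  have dd: "char_inv D (1 - ?v * (y / (y - 1))) =
      C (1 - u * y) / (B (1 - u * y) * B' (1 - u * y))"
    unfolding v(3) D_def char_inv_def char_mult_def using chars ndz
    by (simp add: mult_char_divide mult_char_one)
  show "char_inv A (1 - y) * (A ?v * (char_inv A \<odot> C) (1 - ?v) *
          char_inv B (1 - ?v * ((x - y) / (1 - y))) * char_inv D (1 - ?v * (y / (y - 1)))) =
        A u * (char_inv A \<odot> C) (1 - u) * char_inv B (1 - u * x) * char_inv B' (1 - u * y)"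
    unfolding a ac b dd using ndz
    by (simp add: char_inv_def[of A "1 - y"] char_inv_def[of B' "1 - u * y"] field_simps)
qed

text \<open>
  The substitution \<open>v = (1 - u) / (1 - u y)\<close> is an involution. As it exchanges \<open>0\<close> and \<open>1\<close>, the characters at \<open>u\<close> and \<open>1 - u\<close>
  change places.
  With \<open>X\<close> the new first variable, \<open>1 - v X\<close> is \<open>(1 - y) / (1 - x)\<close> times
  \<open>(1 - u x) / (1 - u y)\<close>. The power of \<open>1 - y\<close> that \<open>B\<close> contributes here cancels against one
  from \<open>1 - v y = (1 - y) / (1 - u y)\<close>, so that \<open>B\<close> survives outside only at \<open>1 - x\<close>.
\<close>

lemma euler_sum_swap_0_1:
  fixes A B B' C :: "'a::{field,finite} \<Rightarrow> complex" and x y :: 'a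
  defines "D \<equiv> char_inv B \<odot> char_inv B' \<odot> C"
  assumes chars: "mult_char A" "mult_char B" "mult_char B'" "mult_char C"
    and x: "x \<noteq> 1" and y: "y \<noteq> 1"
  shows "(\<Sum>u\<in>UNIV. A u * (char_inv A \<odot> C) (1 - u) * char_inv B (1 - u * x) *
            char_inv B' (1 - u * y)) =
         char_inv B (1 - x) * (char_inv A \<odot> char_inv B' \<odot> C) (1 - y) *
         (\<Sum>v\<in>UNIV. (char_inv A \<odot> C) v * A (1 - v) * char_inv B (1 - v * ((y - x) / (1 - x))) *
            char_inv D (1 - v * y))"
  unfolding sum_distrib_left
proof (rule sum_UNIV_reindex_on_support[where S = "{u. 1 - u * y \<noteq> 0}"
        and T = "{v. 1 - v * y \<noteq> 0}"
        and i = "\<lambda>u. (1 - u) / (1 - u * y)" and j = "\<lambda>v. (1 - v) / (1 - v * y)"])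
  let ?K = "char_inv B (1 - x) * (char_inv A \<odot> char_inv B' \<odot> C) (1 - y)"
  have D: "mult_char D"
    unfolding D_def by (intro mult_char_char_mult mult_char_char_inv chars)
  have AC: "mult_char (char_inv A \<odot> C)"
    by (intro mult_char_char_mult mult_char_char_inv chars)
  have x': "1 - x \<noteq> 0" and y': "1 - y \<noteq> 0" using x y by auto
  show "A u * (char_inv A \<odot> C) (1 - u) * char_inv B (1 - u * x) * char_inv B' (1 - u * y) = 0"
    if "u \<notin> {u. 1 - u * y \<noteq> 0}" for u
    using that chars by (simp add: char_inv_def mult_char_def)
  show "?K * ((char_inv A \<odot> C) v * A (1 - v) * char_inv B (1 - v * ((y - x) / (1 - x))) *
          char_inv D (1 - v * y)) = 0"
    if "v \<notin> {v. 1 - v * y \<noteq> 0}" for v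
    using that D by (simp add: char_inv_def mult_char_def)
  have e: "1 - (1 - u) / (1 - u * y) * y = (1 - y) / (1 - u * y)"
    and v: "1 - (1 - u) / (1 - u * y) = u * (1 - y) / (1 - u * y)"
    if "1 - u * y \<noteq> 0" for u
    using that by (simp_all add: field_simps)
  have pole_free: "(1 - u) / (1 - u * y) \<in> {v. 1 - v * y \<noteq> 0}"
    and involution: "(1 - (1 - u) / (1 - u * y)) / (1 - (1 - u) / (1 - u * y) * y) = u"
    if "u \<in> {u. 1 - u * y \<noteq> 0}" for u
  proof -
    have d: "1 - u * y \<noteq> 0" using that by simp
    show "(1 - u) / (1 - u * y) \<in> {v. 1 - v * y \<noteq> 0}"
      unfolding mem_Collect_eq e[OF d] using d y' by simp
    show "(1 - (1 - u) / (1 - u * y)) / (1 - (1 - u) / (1 - u * y) * y) = u"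
      unfolding e[OF d] v[OF d] using d y' by simp
  qed
  show "(1 - u) / (1 - u * y) \<in> {v. 1 - v * y \<noteq> 0}"
    "(1 - u) / (1 - u * y) \<in> {v. 1 - v * y \<noteq> 0}"
    "(1 - (1 - u) / (1 - u * y)) / (1 - (1 - u) / (1 - u * y) * y) = u"
    "(1 - (1 - u) / (1 - u * y)) / (1 - (1 - u) / (1 - u * y) * y) = u"
    if "u \<in> {u. 1 - u * y \<noteq> 0}" for u
    using pole_free[OF that] involution[OF that] by auto
  fix u assume "u \<in> {u. 1 - u * y \<noteq> 0}"
  then have d: "1 - u * y \<noteq> 0" by simp
  let ?v = "(1 - u) / (1 - u * y)"
  have vx: "1 - ?v * ((y - x) / (1 - x)) = (1 - y) * (1 - u * x) / ((1 - x) * (1 - u * y))"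
  proof -
    have "1 - ?v * ((y - x) / (1 - x)) =
        ((1 - x) * (1 - u * y) - (1 - u) * (y - x)) / ((1 - x) * (1 - u * y))"
      using d x' by (subst diff_divide_distrib) (simp add: mult.commute)
    also have "(1 - x) * (1 - u * y) - (1 - u) * (y - x) = (1 - y) * (1 - u * x)"
      by (simp add: algebra_simps)
    finally show ?thesis .
  qed
  show "?K * ((char_inv A \<odot> C) ?v * A (1 - ?v) * char_inv B (1 - ?v * ((y - x) / (1 - x))) *
          char_inv D (1 - ?v * y)) =
        A u * (char_inv A \<odot> C) (1 - u) * char_inv B (1 - u * x) * char_inv B' (1 - u * y)"
  proof -
    have ndz: "A (1 - u * y) \<noteq> 0" "B (1 - u * y) \<noteq> 0" "B' (1 - u * y) \<noteq> 0"
      "C (1 - u * y) \<noteq> 0" "A (1 - y) \<noteq> 0" "B (1 - y) \<noteq> 0" "B' (1 - y) \<noteq> 0" "C (1 - y) \<noteq> 0"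
      "B (1 - x) \<noteq> 0"
      using d x' y' chars by (simp_all add: mult_char_eq_0_iff)
    have ac: "(char_inv A \<odot> C) ?v = (char_inv A \<odot> C) (1 - u) * A (1 - u * y) / C (1 - u * y)"
      by (simp add: mult_char_divide[OF AC] char_mult_def[of _ _ "1 - u * y"]
          char_inv_def[of A "1 - u * y"] field_simps)
    have a: "A (1 - ?v) = A u * A (1 - y) / A (1 - u * y)"
      unfolding v[OF d] using chars by (simp add: mult_char_divide mult_char_mult)
    have b: "char_inv B (1 - ?v * ((y - x) / (1 - x))) =
        char_inv B (1 - u * x) * B (1 - x) * B (1 - u * y) / B (1 - y)"
      unfolding vx char_inv_def using chars
      by (simp add: mult_char_divide mult_char_mult) (simp add: divide_inverse)
    have dd: "char_inv D (1 - ?v * y) =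
        B (1 - y) * B' (1 - y) * C (1 - u * y) / (C (1 - y) * B (1 - u * y) * B' (1 - u * y))"
      unfolding e[OF d] D_def char_inv_def char_mult_def using chars ndz
      by (simp add: mult_char_divide)
    show ?thesis
      unfolding ac a b dd using ndz
      by (simp add: char_inv_def[of B "1 - x"] char_inv_def[of A "1 - y"]
          char_inv_def[of B' "1 - y"] char_inv_def[of B' "1 - u * y"]
          char_mult_def[of _ _ "1 - y"] field_simps)
  qed
qed

theorem theorem3p3:
  fixes p r :: nat
    and A B B' C :: "'a::{field,finite} \<Rightarrow> complex"
    and x y :: 'a
  assumes "prime p" and "r \<ge> 1" and "CARD('a) = p ^ r"
    and "mult_char A" and "mult_char B" and "mult_char B'" and "mult_char C"
  shows "(y \<noteq> 1 \<longrightarrow>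
            triv_char (x - y) * appell_F1 A B B' C x y =
            triv_char x * char_inv A (1 - y) *
              appell_F1 A B (char_inv B \<odot> char_inv B' \<odot> C) C ((x - y) / (1 - y)) (y / (y - 1))) \<and>
         (x \<noteq> 1 \<and> y \<noteq> 1 \<longrightarrow>
            triv_char (x - y) * appell_F1 A B B' C x y =
            triv_char x * C (- 1) * char_inv B (1 - x) *
              (char_inv A \<odot> char_inv B' \<odot> C) (1 - y) *
              appell_F1 (char_inv A \<odot> C) B (char_inv B \<odot> char_inv B' \<odot> C) C ((y - x) / (1 - x)) y)"
proof (intro conjI impI)
  note chars = assms(4-7)
  let ?D = "char_inv B \<odot> char_inv B' \<odot> C"
  {
    assume y: "y \<noteq> 1"
    have "triv_char (x - y) * triv_char (x * y) =
        triv_char x * triv_char ((x - y) / (1 - y) * (y / (y - 1)))"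
      using y by (auto simp: triv_char_def)
    then show "triv_char (x - y) * appell_F1 A B B' C x y =
        triv_char x * char_inv A (1 - y) *
          appell_F1 A B ?D C ((x - y) / (1 - y)) (y / (y - 1))"
      unfolding appell_F1_def euler_sum_fix_0_1[OF chars y] by (simp add: mult_ac)
  }
  assume "x \<noteq> 1 \<and> y \<noteq> 1"
  then have x: "x \<noteq> 1" and y: "y \<noteq> 1" by auto
  let ?X = "(y - x) / (1 - x)"
  have triv: "triv_char (x - y) * triv_char (x * y) = triv_char x * triv_char (?X * y)"
    using x by (auto simp: triv_char_def)
  \<comment> \<open>This is where the outer factor \<open>C (- 1)\<close> comes from.\<close>
  have minus_one: "C (- 1) * (char_inv A \<odot> C \<odot> C) (- 1) = (A \<odot> C) (- 1)"
  proof -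
    have "inverse (A (- 1)) = A (- 1)"
      using mult_char_minus_one_square[OF chars(1)] by (rule inverse_unique)
    then show ?thesis
      using mult_char_minus_one_square[OF chars(4)] by (simp add: char_mult_def char_inv_def)
  qed
  \<comment> \<open>In the transformed function the character at \<open>1 - v\<close> is again \<open>A\<close>. At \<open>0\<close> this rests on both
    sides being extended by \<open>0\<close>, not on cancellation.\<close>
  have inv: "char_inv (char_inv A \<odot> C) \<odot> C = A"
  proof
    fix a
    show "(char_inv (char_inv A \<odot> C) \<odot> C) a = A a"
      using chars by (cases "a = 0") (simp_all add: char_mult_def char_inv_def mult_char_def)
  qed
  let ?K = "char_inv B (1 - x) * (char_inv A \<odot> char_inv B' \<odot> C) (1 - y)"
  let ?S = "\<Sum>v\<in>UNIV. (char_inv A \<odot> C) v * A (1 - v) * char_inv B (1 - v * ?X) *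
    char_inv ?D (1 - v * y)"
  have "triv_char (x - y) * appell_F1 A B B' C x y =
      (triv_char (x - y) * triv_char (x * y)) * (A \<odot> C) (- 1) * (?K * ?S)"
    unfolding appell_F1_def euler_sum_swap_0_1[OF chars x y] by (simp only: mult.assoc)
  also have "\<dots> = triv_char x * C (- 1) * ?K *
      (triv_char (?X * y) * (char_inv A \<odot> C \<odot> C) (- 1) * ?S)"
    unfolding triv minus_one[symmetric] by (simp only: mult_ac)
  finally show "triv_char (x - y) * appell_F1 A B B' C x y =
      triv_char x * C (- 1) * char_inv B (1 - x) * (char_inv A \<odot> char_inv B' \<odot> C) (1 - y) *
        appell_F1 (char_inv A \<odot> C) B ?D C ?X y"
    unfolding appell_F1_def inv by (simp only: mult.assoc)
qed

end
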